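(* Let $p$ be an odd prime with $p\equiv 1 \pmod 4$ and $p\neq 5$. Then $C_{Q_p,\mathbf 1}=6$.
   Context: For an odd prime $p$, $\mathbb Z_p=\mathbb Z/p\mathbb Z$, $U(p)$ is its group of units, and $Q_p=\{x^2:x\in U(p)\}$. A sequence of length $k$ in $\mathbb Z_p$ is an element of $\mathbb Z_p^k$. A sequence $(x_1,\ldots,x_k)$ in $\mathbb Z_p$ is called a $(Q_p,\mathbf 1)$-weighted zero-sum sequence if there exist $a_1,\ldots,a_k\in Q_p$ such that $a_1x_1+\cdots+a_kx_k=0$ and $a_1+\cdots+a_k=0$ in $\mathbb Z_p$. The constant $C_{Q_p,\mathbf 1}$ is the least positive integer $k$ such that every sequence in $\mathbb Z_p$ of length $k$ has a (non-empty) $(Q_p,\mathbf 1)$-weighted zero-sum subsequence consisting of consecutive terms. *)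

theory Defs
  imports "HOL-Number_Theory.Number_Theory" "HOL-Library.Sublist"
begin

text \<open>
  The ring of integers modulo \<open>p\<close> is \<open>residue_ring (int p)\<close>, with carrier \<open>{0..int p - 1}\<close>;
  a sequence in it is a list whose entries lie in this carrier.
\<close>

definition unit_squares :: "nat \<Rightarrow> int set" where
  "unit_squares p =
     {x [^]\<^bsub>residue_ring (int p)\<^esub> (2::nat) | x. x \<in> Units (residue_ring (int p))}"

text \<open>The \<open>(A, 1)\<close>-weighted zero-sum sequences: the same weights kill both the sequence and
  the constant sequence 1.\<close>

definition weighted_zero_sum :: "nat \<Rightarrow> int set \<Rightarrow> int list \<Rightarrow> bool" where
  "weighted_zero_sum p A xs \<longleftrightarrow>
     (\<exists>a. (\<forall>i<length xs. a i \<in> A) \<and>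
        (\<Oplus>\<^bsub>residue_ring (int p)\<^esub>i\<in>{..<length xs}. a i \<otimes>\<^bsub>residue_ring (int p)\<^esub> xs ! i)
          = \<zero>\<^bsub>residue_ring (int p)\<^esub> \<and>
        (\<Oplus>\<^bsub>residue_ring (int p)\<^esub>i\<in>{..<length xs}. a i) = \<zero>\<^bsub>residue_ring (int p)\<^esub>)"

text \<open>The infimum of a nonempty set of naturals is its least element, while that of the empty set
  is 0. As the set below contains only positive numbers, a positive value of the constant
  is attained, so it also says that some \<open>k\<close> has the required property.\<close>

definition weighted_zero_sum_constant :: "nat \<Rightarrow> int set \<Rightarrow> nat" where
  "weighted_zero_sum_constant p A =
     Inf {k. 0 < k \<and>
       (\<forall>xs. length xs = k \<and> set xs \<subseteq> carrier (residue_ring (int p)) \<longrightarrow>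
          (\<exists>ys. ys \<noteq> [] \<and> sublist ys xs \<and> weighted_zero_sum p A ys))}"

end

theory Submission
  imports Defs "HOL-Analysis.Convex"
begin

text \<open>
  Let \<open>Q\<close> be the set of nonzero squares modulo \<open>p\<close>. The hypotheses give \<open>-1 \<in> Q\<close> and \<open>p \<ge> 13\<close>, whence
  every residue is a sum of two elements of \<open>Q\<close>. For a nonsquare \<open>n\<close>, no block of \<open>0, 1, 0, n, 0\<close> is a
  weighted zero-sum sequence: the weights on \<open>1\<close> and \<open>n\<close> would satisfy \<open>a + b n = 0\<close>.

  Conversely, take six terms. Two equal adjacent terms \<open>v, v\<close> have the weights \<open>1, -1\<close>. Otherwise at least
  three terms differ from any given value \<open>v\<close>. If some \<open>v\<close> is repeated, subtract it from all terms: two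
  of the nonzero terms have the same quadratic character, so their weighted sum can be made to
  cancel all the others, and the weights on the copies of \<open>v\<close> can be given any sum. If all six terms are
  distinct, consider the pairs \<open>(\<Sum>a\<^sub>i, \<Sum>a\<^sub>i x\<^sub>i)\<close> with \<open>a\<^sub>i \<in> Q\<close> over three of the terms. Counting
  collisions and applying Cauchy-Schwarz shows that there are more than \<open>p\<^sup>2 / 2\<close> of them, so the two halves
  of the sequence have a common pair, and \<open>-1 \<in> Q\<close> lets them cancel.
\<close>

section \<open>Counting an image through collisions\<close>

text \<open>The fibre sizes \<open>n z\<close> sum to \<open>card T\<close>, and their squares sum
  to the number of collisions. Cauchy-Schwarz against the constant 1 compares the two sums.\<close>

lemma card_sq_le_card_image_mult_collisions:
  assumes "finite T"
  shows "(card T)\<^sup>2 \<le> card (f ` T) * card {(s, t). s \<in> T \<and> t \<in> T \<and> f s = f t}"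
proof -
  define n where "n z = card {t \<in> T. f t = z}" for z
  have T: "T = (\<Union>z\<in>f ` T. {t \<in> T. f t = z})"
    by auto
  have cT: "card T = (\<Sum>z\<in>f ` T. n z)"
    unfolding n_def by (subst T, subst card_UN_disjoint) (use assms in auto)
  have "{(s, t). s \<in> T \<and> t \<in> T \<and> f s = f t} =
    (\<Union>z\<in>f ` T. {t \<in> T. f t = z} \<times> {t \<in> T. f t = z})"
    by auto
  also have "card \<dots> = (\<Sum>z\<in>f ` T. (n z)\<^sup>2)"
    unfolding n_def power2_eq_square
    by (subst card_UN_disjoint) (use assms in \<open>auto simp: card_cartesian_product\<close>)
  finally have cC: "card {(s, t). s \<in> T \<and> t \<in> T \<and> f s = f t} = (\<Sum>z\<in>f ` T. (n z)\<^sup>2)" .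
  have "(\<Sum>z\<in>f ` T. real (n z))\<^sup>2 \<le> (\<Sum>z\<in>f ` T. (real (n z))\<^sup>2) * real (card (f ` T))"
    by (rule sum_squared_le_sum_of_squares)
  hence "real ((\<Sum>z\<in>f ` T. n z)\<^sup>2) \<le> real ((\<Sum>z\<in>f ` T. (n z)\<^sup>2) * card (f ` T))"
    by simp
  thus ?thesis
    unfolding cT cC by (simp only: of_nat_le_iff mult.commute)
qed

section \<open>Arithmetic modulo p\<close>

locale prime_1_mod_4 =
  fixes p :: nat
  assumes prime: "prime p" and cong_1: "[p = 1] (mod 4)" and not_5: "p \<noteq> 5"
begin

lemma p_ge_13: "13 \<le> p"
proof (rule ccontr)
  assume "\<not> 13 \<le> p"
  hence "p \<in> {..<13}" by simp
  hence "p \<in> {0,1,2,3,4,5,6,7,8,9,10,11,12}" by (simp add: eval_nat_numeral lessThan_Suc) blast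
  hence "p = 1 \<or> p = 5 \<or> p = 9"
    using cong_1 by (auto simp: cong_def)
  moreover have "\<not> prime (9::nat)"
    using prime_product[of "3::nat" 3] by auto
  ultimately show False
    using prime not_5 by auto
qed

lemma prime_int: "prime (int p)"
  using prime by simp

lemma p_dvd_mult_iff: "int p dvd a * b \<longleftrightarrow> int p dvd a \<or> int p dvd b"
  using prime_int by (rule prime_dvd_mult_iff)

lemma p_dvd_power2_iff: "int p dvd a\<^sup>2 \<longleftrightarrow> int p dvd a"
  by (simp add: power2_eq_square p_dvd_mult_iff)

lemma not_p_dvd: "0 < n \<Longrightarrow> n < 13 \<Longrightarrow> \<not> int p dvd n"
  using p_ge_13 zdvd_not_zless[of n "int p"] by linarith

lemma p_dvd_2_mult_iff: "int p dvd 2 * a \<longleftrightarrow> int p dvd a"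
  using not_p_dvd[of 2] by (simp add: p_dvd_mult_iff)

lemma obtain_inverse:
  assumes "\<not> int p dvd a"
  obtains b where "int p dvd a * b - 1" "\<not> int p dvd b"
proof -
  have "coprime a (int p)"
    using prime_imp_coprime[OF prime_int assms] by (simp add: coprime_commute)
  then obtain b where "[a * b = 1] (mod int p)"
    using cong_solve_coprime_int by blast
  hence *: "int p dvd a * b - 1"
    by (simp add: cong_iff_dvd_diff)
  moreover have "\<not> int p dvd b"
  proof
    assume "int p dvd b"
    hence "int p dvd a * b - (a * b - 1)"
      using dvd_diff[OF dvd_mult *] by blast
    thus False using not_p_dvd[of 1] by simp
  qed
  ultimately show ?thesis by (rule that)
qed

section \<open>Nonzero squares modulo p\<close>

text \<open>Stated for arbitrary integers, not reduced representatives, so that weights can be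
  handled by polynomial identities and divisibility. The link to \<open>unit_squares p\<close> is
  \<open>unit_squares_iff\<close>.\<close>

definition unit_square :: "int \<Rightarrow> bool" where
  "unit_square a \<longleftrightarrow> (\<exists>y. \<not> int p dvd y \<and> int p dvd a - y\<^sup>2)"

lemma unit_square_not_dvd: "unit_square a \<Longrightarrow> \<not> int p dvd a"
  unfolding unit_square_def using dvd_diffD p_dvd_power2_iff
  by (metis dvd_diff_right_iff)

lemma unit_square_power2: "\<not> int p dvd y \<Longrightarrow> unit_square (y\<^sup>2)"
  unfolding unit_square_def by (metis diff_self dvd_0_right)

lemma unit_square_cong: "unit_square a \<Longrightarrow> int p dvd b - a \<Longrightarrow> unit_square b"
  unfolding unit_square_def by (metis dvd_add diff_add_cancel add_diff_eq)

lemma unit_square_mult: "unit_square a \<Longrightarrow> unit_square b \<Longrightarrow> unit_square (a * b)"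
  unfolding unit_square_def
proof (elim exE conjE)
  fix x y assume *: "\<not> int p dvd x" "\<not> int p dvd y" "int p dvd a - x\<^sup>2" "int p dvd b - y\<^sup>2"
  have "a * b - (x * y)\<^sup>2 = (a - x\<^sup>2) * b + x\<^sup>2 * (b - y\<^sup>2)"
    by (simp add: algebra_simps power2_eq_square)
  hence "int p dvd a * b - (x * y)\<^sup>2"
    using * by simp
  thus "\<exists>z. \<not> int p dvd z \<and> int p dvd a * b - z\<^sup>2"
    using * p_dvd_mult_iff by blast
qed

text \<open>Euler's criterion makes the power congruent to 1 or -1, and these are distinct because p
  does not divide 2. The second form lets the powers of two nonsquares be multiplied.\<close>

lemma unit_square_iff_euler:
  assumes "\<not> int p dvd a"
  shows "unit_square a \<longleftrightarrow> int p dvd a ^ ((p - 1) div 2) - 1"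
    and "\<not> unit_square a \<longleftrightarrow> int p dvd a ^ ((p - 1) div 2) + 1"
proof -
  have "[Legendre a p = a ^ ((p - 1) div 2)] (mod p)"
    using euler_criterion prime p_ge_13 by simp
  hence *: "int p dvd a ^ ((p - 1) div 2) - Legendre a p"
    by (simp add: cong_iff_dvd_diff dvd_diff_commute)
  have "unit_square a \<longleftrightarrow> QuadRes (int p) a"
    unfolding unit_square_def QuadRes_def cong_iff_dvd_diff
    using assms p_dvd_power2_iff
    by (metis cong_iff_dvd_diff cong_sym_eq cong_dvd_iff)
  hence L: "Legendre a p = (if unit_square a then 1 else -1)"
    using assms by (auto simp: Legendre_def cong_0_iff)
  have "\<not> (int p dvd a ^ ((p - 1) div 2) - 1 \<and> int p dvd a ^ ((p - 1) div 2) + 1)"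
  proof
    assume "int p dvd a ^ ((p - 1) div 2) - 1 \<and> int p dvd a ^ ((p - 1) div 2) + 1"
    hence "int p dvd (a ^ ((p - 1) div 2) + 1) - (a ^ ((p - 1) div 2) - 1)"
      using dvd_diff by blast
    thus False using not_p_dvd[of 2] by simp
  qed
  with * L show "unit_square a \<longleftrightarrow> int p dvd a ^ ((p - 1) div 2) - 1"
    and "\<not> unit_square a \<longleftrightarrow> int p dvd a ^ ((p - 1) div 2) + 1"
    by (auto split: if_splits)
qed

text \<open>For p = 4k + 1 the Euler exponent is 2k, which is even.\<close>

lemma unit_square_minus_1: "unit_square (-1)"
proof -
  obtain k where "p = 4 * k + 1"
    using cong_1 p_ge_13 by (metis cong_def mod_less one_less_numeral_iff semiring_norm(76) mult_div_mod_eq)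
  hence "even ((p - 1) div 2)" by simp
  thus ?thesis
    using not_p_dvd[of 1] by (subst unit_square_iff_euler(1)) auto
qed

lemma unit_square_mult_nonsquares:
  assumes "\<not> int p dvd a" "\<not> int p dvd b" "\<not> unit_square a" "\<not> unit_square b"
  shows "unit_square (a * b)"
proof -
  let ?m = "(p - 1) div 2"
  \<comment> \<open>With A, B the two powers, (A + 1) B - (B + 1) = A B - 1, so two values -1
    multiply to 1.\<close>
  have "int p dvd (a ^ ?m + 1) * b ^ ?m - (b ^ ?m + 1)"
    using assms unit_square_iff_euler(2) by (intro dvd_diff) auto
  hence "int p dvd (a * b) ^ ?m - 1"
    by (simp add: algebra_simps power_mult_distrib)
  thus ?thesis
    using assms by (simp add: unit_square_iff_euler(1) p_dvd_mult_iff)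
qed

lemma obtain_half: obtains h where "int p dvd 2 * h - 1" "\<not> int p dvd h"
  using obtain_inverse not_p_dvd[of 2] by auto

text \<open>Squaring maps the finite set of nonzero residues to itself but identifies 1 and p - 1,
  so it is not injective and hence not surjective.\<close>

lemma exists_nonsquare: obtains n where "0 < n" "n < int p" "\<not> unit_square n"
proof -
  let ?F = "{1..int p - 1}"
  let ?g = "\<lambda>y. y\<^sup>2 mod int p"
  have "(int p - 1)\<^sup>2 = 1 + int p * (int p - 2)"
    by (simp add: power2_eq_square algebra_simps)
  hence "?g 1 = ?g (int p - 1)"
    by (metis mod_mult_self2 one_power2)
  hence "\<not> inj_on ?g ?F"
    using p_ge_13 inj_onD[of ?g ?F 1 "int p - 1"] by auto
  hence "?g ` ?F \<noteq> ?F"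
    by (metis eq_card_imp_inj_on finite_atLeastAtMost_int)
  moreover have "?g ` ?F \<subseteq> ?F"
  proof clarify
    fix y assume "y \<in> ?F"
    hence "\<not> int p dvd y" using zdvd_not_zless[of y "int p"] by auto
    hence "?g y \<noteq> 0" by (simp add: p_dvd_power2_iff flip: dvd_eq_mod_eq_0)
    moreover have "0 \<le> ?g y" "?g y < int p" using p_ge_13 by auto
    ultimately show "?g y \<in> ?F" by auto
  qed
  ultimately obtain n where n: "n \<in> ?F" "n \<notin> ?g ` ?F"
    by blast
  have "\<not> unit_square n"
  proof
    assume "unit_square n"
    then obtain y where y: "\<not> int p dvd y" "int p dvd n - y\<^sup>2"
      by (auto simp: unit_square_def)
    have "n mod int p = y\<^sup>2 mod int p"
      using y by (simp add: mod_eq_dvd_iff)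
    hence "n = ?g (y mod int p)"
      using n by (simp add: power_mod)
    moreover have "0 \<le> y mod int p" "y mod int p < int p" "y mod int p \<noteq> 0"
      using y p_ge_13 by (auto simp: dvd_eq_mod_eq_0)
    hence "y mod int p \<in> ?F" by auto
    ultimately show False using n by blast
  qed
  moreover have "0 < n" "n < int p" using n by auto
  ultimately show ?thesis using that by blast
qed

section \<open>Prescribing the value of a weighted sum\<close>

lemma unit_square_diff:
  assumes "\<not> int p dvd x" "\<not> int p dvd y" "int p dvd c - (y\<^sup>2 - x\<^sup>2)"
  shows "\<exists>a b. unit_square a \<and> unit_square b \<and> int p dvd a + b - c"
proof (intro exI conjI)
  show "unit_square (y\<^sup>2)" "unit_square (-1 * x\<^sup>2)"
    using unit_square_mult[OF unit_square_minus_1] assms by (auto intro: unit_square_power2)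
  show "int p dvd y\<^sup>2 + -1 * x\<^sup>2 - c"
    using assms(3) by (simp add: dvd_diff_commute)
qed

text \<open>Uses \<open>4c = (1 + c)\<^sup>2 - (1 - c)\<^sup>2\<close>, except for \<open>c = \<plusminus>1\<close>, where one of the squares vanishes and \<open>16 = 5\<^sup>2 - 3\<^sup>2\<close> serves.\<close>

lemma unit_square_sum_surj: "\<exists>a b. unit_square a \<and> unit_square b \<and> int p dvd a + b - c"
proof -
  \<comment> \<open>\<open>h\<close> plays the role of 1/2: both \<open>4 * h\<^sup>2\<close> and
    \<open>16 * h ^ 4\<close> are congruent to 1, which turns the identities for 4c and 16 into ones
    for c and 1.\<close>
  obtain h where h: "int p dvd 2 * h - 1" "\<not> int p dvd h"
    by (rule obtain_half)
  have h2: "int p dvd 4 * h\<^sup>2 - 1"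
  proof -
    have "4 * h\<^sup>2 - 1 = (2 * h - 1) * (2 * h + 1)"
      by (simp add: algebra_simps power2_eq_square)
    thus ?thesis using h by simp
  qed
  have h4: "int p dvd 16 * h ^ 4 - 1"
  proof -
    have "16 * h ^ 4 - 1 = (4 * h\<^sup>2 - 1) * (4 * h\<^sup>2 + 1)"
      by (simp add: algebra_simps power2_eq_square power4_eq_xxxx)
    thus ?thesis using h2 by simp
  qed
  have n: "\<not> int p dvd 5 * h\<^sup>2" "\<not> int p dvd 3 * h\<^sup>2"
    using h not_p_dvd[of 3] not_p_dvd[of 5] by (simp_all add: p_dvd_mult_iff p_dvd_power2_iff)
  consider "int p dvd c - 1" | "int p dvd c + 1" | "\<not> int p dvd c - 1" "\<not> int p dvd c + 1"
    by blast
  thus ?thesis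
  proof cases
    case 1
    have "c - ((5 * h\<^sup>2)\<^sup>2 - (3 * h\<^sup>2)\<^sup>2) = (c - 1) - (16 * h ^ 4 - 1)"
      by (simp add: algebra_simps power2_eq_square power4_eq_xxxx)
    hence "int p dvd c - ((5 * h\<^sup>2)\<^sup>2 - (3 * h\<^sup>2)\<^sup>2)"
      using dvd_diff[OF 1 h4] by simp
    thus ?thesis
      using n by (intro unit_square_diff[of "3 * h\<^sup>2" "5 * h\<^sup>2"])
  next
    case 2
    have "c - ((3 * h\<^sup>2)\<^sup>2 - (5 * h\<^sup>2)\<^sup>2) = (c + 1) + (16 * h ^ 4 - 1)"
      by (simp add: algebra_simps power2_eq_square power4_eq_xxxx)
    hence "int p dvd c - ((3 * h\<^sup>2)\<^sup>2 - (5 * h\<^sup>2)\<^sup>2)"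
      using dvd_add[OF 2 h4] by simp
    thus ?thesis
      using n by (intro unit_square_diff[of "5 * h\<^sup>2" "3 * h\<^sup>2"])
  next
    case 3
    have "c - ((h * (c + 1))\<^sup>2 - (h * (c - 1))\<^sup>2) = - c * (4 * h\<^sup>2 - 1)"
      by (simp add: algebra_simps power2_eq_square)
    thus ?thesis
      using 3 h h2 by (intro unit_square_diff[of "h * (c - 1)" "h * (c + 1)"]) (auto simp: p_dvd_mult_iff)
  qed
qed

text \<open>Multiplied by x, the goal reads a x^2 + b (x y) = t x. Both x^2 and x y = s^2 are
  nonzero squares, so rescaling the weights by the inverses of x^2 and s^2 reduces it to writing t x
  as a sum of two nonzero squares.\<close>

lemma unit_square_comb_surj:
  assumes "unit_square (x * y)"
  shows "\<exists>a b. unit_square a \<and> unit_square b \<and> int p dvd a * x + b * y - t"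
proof -
  have x: "\<not> int p dvd x"
    using unit_square_not_dvd[OF assms] by (auto simp: p_dvd_mult_iff)
  obtain i where i: "int p dvd x * i - 1" "\<not> int p dvd i"
    using obtain_inverse[OF x] .
  obtain s where s: "\<not> int p dvd s" "int p dvd x * y - s\<^sup>2"
    using assms by (auto simp: unit_square_def)
  obtain j where j: "int p dvd s * j - 1" "\<not> int p dvd j"
    using obtain_inverse[OF s(1)] .
  obtain a b where ab: "unit_square a" "unit_square b" "int p dvd a + b - t * x"
    using unit_square_sum_surj by blast
  have "unit_square (a * i\<^sup>2)" "unit_square (b * j\<^sup>2)"
    using ab i j by (auto intro: unit_square_mult unit_square_power2)
  moreover have "int p dvd (a * i\<^sup>2) * x + (b * j\<^sup>2) * y - t"
  proof -
    have "int p dvd x * ((a * i\<^sup>2) * x + (b * j\<^sup>2) * y - t)"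
    proof -
      have "x * ((a * i\<^sup>2) * x + (b * j\<^sup>2) * y - t) = (a + b - t * x) +
          a * (x * i + 1) * (x * i - 1) + b * j\<^sup>2 * (x * y - s\<^sup>2) + b * (s * j + 1) * (s * j - 1)"
        by (simp add: algebra_simps power2_eq_square)
      thus ?thesis using ab i j s by simp
    qed
    thus ?thesis using x by (simp add: p_dvd_mult_iff)
  qed
  ultimately show ?thesis by blast
qed

text \<open>All indices other than i and j get weight 1; the weights at i and j then compensate for
  whatever these contribute.\<close>

lemma unit_square_sum_surj_on:
  assumes "finite I" "i \<in> I" "j \<in> I" "i \<noteq> j" "unit_square (x i * x j)"
  shows "\<exists>a. (\<forall>k\<in>I. unit_square (a k)) \<and> int p dvd (\<Sum>k\<in>I. a k * x k) - t"
proof -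
  let ?J = "I - {i, j}"
  obtain b c where bc: "unit_square b" "unit_square c" "int p dvd b * x i + c * x j - (t - (\<Sum>k\<in>?J. x k))"
    using unit_square_comb_surj[OF assms(5)] by blast
  let ?a = "\<lambda>k. if k = i then b else if k = j then c else 1"
  have "(\<Sum>k\<in>I. ?a k * x k) = b * x i + (c * x j + (\<Sum>k\<in>?J. ?a k * x k))"
  proof -
    have "I = insert i (insert j ?J)" using assms by auto
    hence "(\<Sum>k\<in>I. ?a k * x k) = (\<Sum>k\<in>insert i (insert j ?J). ?a k * x k)"
      by (rule arg_cong)
    also have "\<dots> = b * x i + (c * x j + (\<Sum>k\<in>?J. ?a k * x k))"
      using assms(1,4) by (subst sum.insert; simp)+
    finally show ?thesis .
  qed
  also have "(\<Sum>k\<in>?J. ?a k * x k) = (\<Sum>k\<in>?J. x k)"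
    by (intro sum.cong) auto
  finally have "int p dvd (\<Sum>k\<in>I. ?a k * x k) - t"
    using bc by (simp add: algebra_simps)
  moreover have "unit_square 1" using unit_square_power2[of 1] not_p_dvd[of 1] by simp
  ultimately show ?thesis
    using bc by (intro exI[of _ ?a]) auto
qed

text \<open>The quadratic character takes two values, so two of three units share it, and their
  product is a square.\<close>

lemma unit_square_pair_of_three:
  assumes "\<not> int p dvd x" "\<not> int p dvd y" "\<not> int p dvd z"
  shows "unit_square (x * y) \<or> unit_square (x * z) \<or> unit_square (y * z)"
  using assms unit_square_mult unit_square_mult_nonsquares by metis

text \<open>The terms different from v are weighted first, to make the sum of the shifted terms
  vanish. The copies of v do not affect that sum, so their weights remain free to cancel the total
  weight.\<close>

lemma unit_square_weights_of_repetition: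
  assumes "finite I" "i \<in> I" "j \<in> I" "i \<noteq> j" "int p dvd x i - v" "int p dvd x j - v"
    and "k \<in> I" "l \<in> I" "m \<in> I" "k \<noteq> l" "k \<noteq> m" "l \<noteq> m"
    and "\<not> int p dvd x k - v" "\<not> int p dvd x l - v" "\<not> int p dvd x m - v"
  shows "\<exists>a. (\<forall>i\<in>I. unit_square (a i)) \<and> int p dvd (\<Sum>i\<in>I. a i * x i) \<and> int p dvd (\<Sum>i\<in>I. a i)"
proof -
  define A where "A = {i \<in> I. int p dvd x i - v}"
  define B where "B = {i \<in> I. \<not> int p dvd x i - v}"
  have AB: "finite A" "finite B" "I = A \<union> B" "A \<inter> B = {}"
    using assms by (auto simp: A_def B_def)
  obtain q r where qr: "q \<in> B" "r \<in> B" "q \<noteq> r" "unit_square ((x q - v) * (x r - v))"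
    using unit_square_pair_of_three[OF assms(13-15)] assms unfolding B_def by blast
  obtain b where b: "\<forall>i\<in>B. unit_square (b i)" "int p dvd (\<Sum>i\<in>B. b i * (x i - v)) - 0"
    using unit_square_sum_surj_on[where x = "\<lambda>i. x i - v", OF AB(2) qr] by blast
  have "unit_square (1 * 1)" using unit_square_power2[of 1] not_p_dvd[of 1] by simp
  \<comment> \<open>Applied to the constant sequence 1; the repetition of v supplies the two indices
    that this requires.\<close>
  then obtain a where a: "\<forall>i\<in>A. unit_square (a i)" "int p dvd (\<Sum>i\<in>A. a i * 1) - (- (\<Sum>i\<in>B. b i))"
    using unit_square_sum_surj_on[where x = "\<lambda>i. 1" and I = A and i = i and j = j] assms AB
    unfolding A_def by blast
  define w where "w i = (if i \<in> A then a i else b i)" for i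
  have 1: "\<forall>i\<in>I. unit_square (w i)" using a b AB by (auto simp: w_def)
  have split: "(\<Sum>i\<in>I. w i * f i) = (\<Sum>i\<in>A. a i * f i) + (\<Sum>i\<in>B. b i * f i)" for f
  proof -
    have "(\<Sum>i\<in>A. w i * f i) = (\<Sum>i\<in>A. a i * f i)" "(\<Sum>i\<in>B. w i * f i) = (\<Sum>i\<in>B. b i * f i)"
      using AB by (auto simp: w_def intro!: sum.cong)
    thus ?thesis using AB by (simp add: sum.union_disjoint)
  qed
  have 2: "int p dvd (\<Sum>i\<in>I. w i)"
    using split[of "\<lambda>_. 1"] a by simp
  have "int p dvd (\<Sum>i\<in>A. a i * (x i - v))"
    by (intro dvd_sum) (auto simp: A_def)
  hence "int p dvd (\<Sum>i\<in>I. w i * (x i - v))"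
    using split[of "\<lambda>i. x i - v"] b by simp
  \<comment> \<open>As the total weight vanishes, undoing the shift by v leaves the weighted sum
    unchanged modulo p.\<close>
  hence "int p dvd (\<Sum>i\<in>I. w i * (x i - v)) + v * (\<Sum>i\<in>I. w i)"
    using 2 by simp
  hence "int p dvd (\<Sum>i\<in>I. w i * x i)"
    by (simp add: algebra_simps sum_subtractf sum_distrib_left)
  thus ?thesis using 1 2 by blast
qed

section \<open>Counting the weighted sums of three distinct terms\<close>

abbreviation units :: "int set" where "units \<equiv> {1..int p - 1}"

lemma not_dvd_of_unit: "a \<in> units \<Longrightarrow> \<not> int p dvd a"
  using zdvd_not_zless[of a "int p"] by auto

lemma mod_in_units: "\<not> int p dvd a \<Longrightarrow> a mod int p \<in> units"
  using p_ge_13 pos_mod_bound[of "int p" a] pos_mod_sign[of "int p" a]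
  unfolding dvd_eq_mod_eq_0 atLeastAtMost_iff by linarith

lemma card_units: "card units = p - 1"
  by (simp add: nat_diff_distrib')

lemma unit_eqI:
  assumes "a \<in> units" "b \<in> units" "int p dvd a - b"
  shows "a = b"
  using assms by (metis atLeastAtMost_iff mod_eq_dvd_iff mod_pos_pos_trivial
    zle_diff1_eq zero_less_one order_less_le_trans order_less_imp_le)

lemma unit_power2_eq_cases:
  assumes "a \<in> units" "b \<in> units" "int p dvd a\<^sup>2 - b\<^sup>2"
  shows "b = a \<or> b = int p - a"
proof -
  have "a\<^sup>2 - b\<^sup>2 = (a - b) * (a + b)"
    by (simp add: algebra_simps power2_eq_square)
  hence "int p dvd a - b \<or> int p dvd a + b"
    using assms(3) by (simp add: p_dvd_mult_iff)
  moreover have "a = int p - b" if "int p dvd a + b"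
  proof (rule unit_eqI)
    show "int p - b \<in> units" using assms by auto
    have "int p dvd (a + b) - int p" using that by simp
    thus "int p dvd a - (int p - b)" by (simp add: algebra_simps)
  qed (use assms in auto)
  ultimately show ?thesis
    using unit_eqI assms by force
qed

text \<open>Dividing the difference of squares by the nonzero a - b recovers a + b. Sum and
  difference determine both numbers because 2 is invertible.\<close>

lemma unit_pair_eqI:
  assumes "a \<in> units" "b \<in> units" "a' \<in> units" "b' \<in> units"
    and eq: "(a - b) mod int p = (a' - b') mod int p"
    and sq: "int p dvd (a\<^sup>2 - b\<^sup>2) - (a'\<^sup>2 - b'\<^sup>2)" and nz: "\<not> int p dvd a\<^sup>2 - b\<^sup>2"
  shows "a = a' \<and> b = b'"
proof -
  have d: "int p dvd (a - b) - (a' - b')"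
    using eq by (simp add: mod_eq_dvd_iff)
  have "(a - b) * ((a + b) - (a' + b')) =
      ((a\<^sup>2 - b\<^sup>2) - (a'\<^sup>2 - b'\<^sup>2)) - ((a - b) - (a' - b')) * (a' + b')"
    by (simp add: algebra_simps power2_eq_square)
  hence "int p dvd (a - b) * ((a + b) - (a' + b'))"
    using sq d by (metis dvd_diff dvd_mult2)
  moreover have "\<not> int p dvd a - b"
    using nz dvd_mult[of "int p" "a - b" "a + b"]
    by (auto simp: power2_eq_square square_diff_square_factored)
  ultimately have s: "int p dvd (a + b) - (a' + b')"
    by (simp add: p_dvd_mult_iff)
  have "2 * (a - a') = ((a + b) - (a' + b')) + ((a - b) - (a' - b'))"
    "2 * (b - b') = ((a + b) - (a' + b')) - ((a - b) - (a' - b'))"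
    by simp_all
  hence "int p dvd 2 * (a - a')" "int p dvd 2 * (b - b')"
    using s d by (metis dvd_add, metis dvd_diff)
  thus ?thesis
    using assms(1-4) unit_eqI unfolding p_dvd_2_mult_iff by blast
qed

text \<open>Parametrised by square roots of the weights, so that the domain is a full cube of
  \<open>units\<close> and collisions become polynomial congruences.\<close>

definition triple_sum :: "int \<Rightarrow> int \<Rightarrow> int \<Rightarrow> int \<times> int \<times> int \<Rightarrow> int \<times> int" where
  "triple_sum x y z = (\<lambda>(a, b, c).
     ((a\<^sup>2 + b\<^sup>2 + c\<^sup>2) mod int p, (a\<^sup>2 * x + b\<^sup>2 * y + c\<^sup>2 * z) mod int p))"

definition triple_collisions ::
  "int \<Rightarrow> int \<Rightarrow> int \<Rightarrow> ((int \<times> int \<times> int) \<times> (int \<times> int \<times> int)) set" where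
  "triple_collisions x y z = {(s, t). s \<in> units \<times> units \<times> units \<and> t \<in> units \<times> units \<times> units
     \<and> triple_sum x y z s = triple_sum x y z t}"

text \<open>Eliminates b, respectively a, from the two congruences that make up a collision.\<close>

lemma triple_collisionD:
  assumes "((a, b, c), (a', b', c')) \<in> triple_collisions x y z"
  shows "int p dvd (x - y) * (a\<^sup>2 - a'\<^sup>2) + (z - y) * (c\<^sup>2 - c'\<^sup>2)"
    and "int p dvd (y - x) * (b\<^sup>2 - b'\<^sup>2) + (z - x) * (c\<^sup>2 - c'\<^sup>2)"
proof -
  have e: "int p dvd (a\<^sup>2 + b\<^sup>2 + c\<^sup>2) - (a'\<^sup>2 + b'\<^sup>2 + c'\<^sup>2)" (is "_ dvd ?e")
    and f: "int p dvd (a\<^sup>2 * x + b\<^sup>2 * y + c\<^sup>2 * z) - (a'\<^sup>2 * x + b'\<^sup>2 * y + c'\<^sup>2 * z)" (is "_ dvd ?f")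
    using assms by (auto simp: triple_collisions_def triple_sum_def mod_eq_dvd_iff)
  have "(x - y) * (a\<^sup>2 - a'\<^sup>2) + (z - y) * (c\<^sup>2 - c'\<^sup>2) = ?f - y * ?e"
    "(y - x) * (b\<^sup>2 - b'\<^sup>2) + (z - x) * (c\<^sup>2 - c'\<^sup>2) = ?f - x * ?e"
    by (simp_all add: algebra_simps)
  thus "int p dvd (x - y) * (a\<^sup>2 - a'\<^sup>2) + (z - y) * (c\<^sup>2 - c'\<^sup>2)"
    "int p dvd (y - x) * (b\<^sup>2 - b'\<^sup>2) + (z - x) * (c\<^sup>2 - c'\<^sup>2)"
    using e f by (metis dvd_diff dvd_mult)+
qed

lemma triple_collisions_units:
  assumes "((a, b, c), (a', b', c')) \<in> triple_collisions x y z"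
  shows "a \<in> units" "b \<in> units" "c \<in> units" "a' \<in> units" "b' \<in> units" "c' \<in> units"
  using assms by (auto simp: triple_collisions_def)

text \<open>The coefficients of the eliminated congruences are units, so the three differences of
  squares vanish together or not at all. \<open>D\<close> collects the first kind of collision and
  gives the cubic term; \<open>E\<close> collects the second and gives the quartic one.\<close>

lemma card_triple_collisions_le:
  assumes "\<not> int p dvd x - y" "\<not> int p dvd x - z" "\<not> int p dvd y - z"
  shows "card (triple_collisions x y z) \<le> 8 * (p - 1) ^ 3 + (p - 1) ^ 4"
proof -
  let ?C = "triple_collisions x y z"
  define D where "D = {((a, b, c), (a', b', c')) | a b c a' b' c'.
    ((a, b, c), (a', b', c')) \<in> ?C \<and> int p dvd c\<^sup>2 - c'\<^sup>2}"
  define E where "E = {((a, b, c), (a', b', c')) | a b c a' b' c'.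
    ((a, b, c), (a', b', c')) \<in> ?C \<and> \<not> int p dvd c\<^sup>2 - c'\<^sup>2}"
  have nz: "\<not> int p dvd y - x" "\<not> int p dvd z - x" "\<not> int p dvd z - y"
    using assms by (simp_all add: dvd_diff_commute)
  have dvd_iff: "int p dvd a\<^sup>2 - a'\<^sup>2 \<longleftrightarrow> int p dvd c\<^sup>2 - c'\<^sup>2" "int p dvd b\<^sup>2 - b'\<^sup>2 \<longleftrightarrow> int p dvd c\<^sup>2 - c'\<^sup>2"
    if C: "((a, b, c), (a', b', c')) \<in> ?C" for a b c a' b' c'
  proof -
    have "int p dvd (x - y) * (a\<^sup>2 - a'\<^sup>2) \<longleftrightarrow> int p dvd (z - y) * (c\<^sup>2 - c'\<^sup>2)"
      "int p dvd (y - x) * (b\<^sup>2 - b'\<^sup>2) \<longleftrightarrow> int p dvd (z - x) * (c\<^sup>2 - c'\<^sup>2)"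
      using triple_collisionD[OF C] by (metis dvd_add_right_iff dvd_add_left_iff)+
    thus "int p dvd a\<^sup>2 - a'\<^sup>2 \<longleftrightarrow> int p dvd c\<^sup>2 - c'\<^sup>2" "int p dvd b\<^sup>2 - b'\<^sup>2 \<longleftrightarrow> int p dvd c\<^sup>2 - c'\<^sup>2"
      using assms nz by (simp_all add: p_dvd_mult_iff)
  qed

  \<comment> \<open>Equal squares determine a root up to sign, recorded by the Booleans.\<close>
  have "card D \<le> card ((units \<times> units \<times> units) \<times> (UNIV :: (bool \<times> bool \<times> bool) set))"
  proof (rule card_inj_on_le)
    let ?g = "\<lambda>((a, b, c), (a', b', c')). ((a, b, c), (a' = a, b' = b, c' = c))"
    show "?g ` D \<subseteq> (units \<times> units \<times> units) \<times> UNIV"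
      by (auto simp: D_def triple_collisions_def)
    show "inj_on ?g D"
    proof (rule inj_onI)
      fix s t assume st: "s \<in> D" "t \<in> D" "?g s = ?g t"
      obtain a b c a' b' c' where s: "s = ((a, b, c), (a', b', c'))" by (metis prod_cases3 surj_pair)
      obtain A' B' C' where t: "t = ((a, b, c), (A', B', C'))" using st s by (cases t) auto
      have *: "(a' = a) = (A' = a)" "(b' = b) = (B' = b)" "(c' = c) = (C' = c)"
        using st s t by auto
      have **: "((a, b, c), (a', b', c')) \<in> ?C" "int p dvd c\<^sup>2 - c'\<^sup>2"
        "((a, b, c), (A', B', C')) \<in> ?C" "int p dvd c\<^sup>2 - C'\<^sup>2"
        using st s t by (auto simp: D_def)
      note U = triple_collisions_units[OF **(1)] triple_collisions_units[OF **(3)]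
      have "int p dvd a\<^sup>2 - a'\<^sup>2" "int p dvd a\<^sup>2 - A'\<^sup>2" "int p dvd b\<^sup>2 - b'\<^sup>2" "int p dvd b\<^sup>2 - B'\<^sup>2"
        using dvd_iff[OF **(1)] dvd_iff[OF **(3)] **(2,4) by simp_all
      hence "a' = a \<or> a' = int p - a" "A' = a \<or> A' = int p - a"
        "b' = b \<or> b' = int p - b" "B' = b \<or> B' = int p - b"
        "c' = c \<or> c' = int p - c" "C' = c \<or> C' = int p - c"
        using unit_power2_eq_cases U **(2,4) by blast+
      hence "a' = A'" "b' = B'" "c' = C'"
        using * by metis+
      thus "s = t"
        unfolding s t by simp
    qed
  qed simp
  also have "\<dots> = 8 * (p - 1) ^ 3"
    by (simp add: card_cartesian_product card_units power3_eq_cube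
      del: card_atLeastAtMost_int flip: UNIV_Times_UNIV)
  finally have D: "card D \<le> 8 * (p - 1) ^ 3" .

  \<comment> \<open>Given \<open>c\<close> and \<open>c'\<close>, the nonzero number \<open>a\<^sup>2 - a'\<^sup>2\<close> is determined, so \<open>a - a'\<close> determines \<open>a + a'\<close>;
    likewise for \<open>b\<close>.\<close>
  have "card E \<le> card (units \<times> units \<times> units \<times> units)"
  proof (rule card_inj_on_le)
    let ?g = "\<lambda>((a, b, c), (a', b', c')). ((a - a') mod int p, (b - b') mod int p, c, c')"
    show "?g ` E \<subseteq> units \<times> units \<times> units \<times> units"
    proof (rule image_subsetI)
      fix s assume "s \<in> E"
      then obtain a b c a' b' c' where s: "s = ((a, b, c), (a', b', c'))"
        and C: "((a, b, c), (a', b', c')) \<in> ?C" "\<not> int p dvd c\<^sup>2 - c'\<^sup>2"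
        unfolding E_def by auto
      have "\<not> int p dvd a - a'" "\<not> int p dvd b - b'"
        using dvd_iff[OF C(1)] C(2) by (auto simp: power2_eq_square square_diff_square_factored)
      thus "?g s \<in> units \<times> units \<times> units \<times> units"
        using triple_collisions_units[OF C(1)] unfolding s
        by (simp add: mod_in_units del: atLeastAtMost_iff)
    qed
    show "inj_on ?g E"
    proof (rule inj_onI)
      fix s t assume st: "s \<in> E" "t \<in> E" "?g s = ?g t"
      obtain a b c a' b' c' where s: "s = ((a, b, c), (a', b', c'))" by (metis prod_cases3 surj_pair)
      obtain A B A' B' where t: "t = ((A, B, c), (A', B', c'))" using st s by (cases t) auto
      have *: "(a - a') mod int p = (A - A') mod int p" "(b - b') mod int p = (B - B') mod int p"
        using st s t by auto
      have **: "((a, b, c), (a', b', c')) \<in> ?C" "((A, B, c), (A', B', c')) \<in> ?C"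
        "\<not> int p dvd c\<^sup>2 - c'\<^sup>2"
        using st s t by (auto simp: E_def)
      have "int p dvd (x - y) * ((a\<^sup>2 - a'\<^sup>2) - (A\<^sup>2 - A'\<^sup>2))"
        "int p dvd (y - x) * ((b\<^sup>2 - b'\<^sup>2) - (B\<^sup>2 - B'\<^sup>2))"
        using dvd_diff[OF triple_collisionD(1)[OF **(1)] triple_collisionD(1)[OF **(2)]]
          dvd_diff[OF triple_collisionD(2)[OF **(1)] triple_collisionD(2)[OF **(2)]]
        by (simp_all add: right_diff_distrib)
      hence sq: "int p dvd (a\<^sup>2 - a'\<^sup>2) - (A\<^sup>2 - A'\<^sup>2)" "int p dvd (b\<^sup>2 - b'\<^sup>2) - (B\<^sup>2 - B'\<^sup>2)"
        using assms(1) nz by (simp_all add: p_dvd_mult_iff)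
      have "a = A \<and> a' = A'" "b = B \<and> b' = B'"
        using triple_collisions_units[OF **(1)] triple_collisions_units[OF **(2)]
          dvd_iff[OF **(1)] **(3) * sq by (intro unit_pair_eqI; simp)+
      thus "s = t" unfolding s t by simp
    qed
  qed simp
  also have "\<dots> = (p - 1) ^ 4"
    by (simp add: card_cartesian_product card_units power4_eq_xxxx
      del: card_atLeastAtMost_int)
  finally have E: "card E \<le> (p - 1) ^ 4" .

  have "?C = D \<union> E"
    unfolding D_def E_def by auto
  thus ?thesis
    using order_trans[OF card_Un_le add_mono[OF D E]] by simp
qed

text \<open>With M = p - 1, Cauchy-Schwarz bounds the image below by M^6 / (8 M^3 + M^4) = M^3 / (M
  + 8), which exceeds half of (M + 1)^2 once M is at least 12.\<close>

lemma card_triple_sums: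
  assumes "\<not> int p dvd x - y" "\<not> int p dvd x - z" "\<not> int p dvd y - z"
  shows "p\<^sup>2 < 2 * card (triple_sum x y z ` (units \<times> units \<times> units))" (is "_ < 2 * ?c")
proof (rule ccontr)
  assume "\<not> p\<^sup>2 < 2 * ?c"
  hence c: "2 * ?c \<le> p\<^sup>2" by simp
  obtain k where k: "p = 13 + k"
    using p_ge_13 le_Suc_ex by blast
  define M where "M = p - 1"
  have M: "p = M + 1" "M = 12 + k" using k by (auto simp: M_def)
  have cT: "card (units \<times> units \<times> units) = M ^ 3"
    by (simp add: card_cartesian_product card_units M_def power3_eq_cube del: card_atLeastAtMost_int)
  have "(M ^ 3)\<^sup>2 \<le> ?c * card (triple_collisions x y z)"
    using card_sq_le_card_image_mult_collisions[of "units \<times> units \<times> units" "triple_sum x y z"]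
    unfolding cT triple_collisions_def by simp
  also have "\<dots> \<le> ?c * (8 * M ^ 3 + M ^ 4)"
    using card_triple_collisions_le[OF assms] by (simp add: M_def)
  finally have "M ^ 3 * M ^ 3 \<le> M ^ 3 * (?c * (8 + M))"
    by (simp add: algebra_simps power2_eq_square power3_eq_cube power4_eq_xxxx)
  moreover have "0 < M ^ 3"
    using M(2) by simp
  ultimately have "M ^ 3 \<le> ?c * (8 + M)"
    by (simp only: mult_le_cancel1)
  hence "2 * M ^ 3 \<le> (2 * ?c) * (8 + M)"
    by simp
  also have "\<dots> \<le> (M + 1)\<^sup>2 * (8 + M)"
    using c unfolding M(1) by (rule mult_le_mono1)
  \<comment> \<open>The inequality reached amounts to M^3 <= 10 M^2 + 17 M + 8. It already fails at
    M = 12, where it would say 1728 <= 1652, but it holds at M = 11, so the bound 13 on p is just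
    enough.\<close>
  finally show False
    unfolding M(2) by (simp add: algebra_simps power2_eq_square power3_eq_cube)
qed

lemma unit_square_weights_of_distinct_six:
  assumes "\<And>i j. i < 6 \<Longrightarrow> j < i \<Longrightarrow> \<not> int p dvd x i - x j"
  shows "\<exists>a. (\<forall>i<6. unit_square (a i)) \<and> int p dvd (\<Sum>i<(6::nat). a i * x i) \<and> int p dvd (\<Sum>i<(6::nat). a i)"
proof -
  let ?T = "units \<times> units \<times> units"
  \<comment> \<open>The indices descend because the assumption only provides differences with the
    larger index first.\<close>
  let ?A = "triple_sum (x 2) (x 1) (x 0) ` ?T" and ?B = "triple_sum (x 5) (x 4) (x 3) ` ?T"
  let ?P = "{0..<int p} \<times> {0..<int p}"
  have A: "p\<^sup>2 < 2 * card ?A" and B: "p\<^sup>2 < 2 * card ?B"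
    by (intro card_triple_sums assms; simp)+
  have sub: "?A \<union> ?B \<subseteq> ?P"
    using p_ge_13 by (auto simp: triple_sum_def)
  have "?A \<inter> ?B \<noteq> {}"
  proof
    assume "?A \<inter> ?B = {}"
    hence "card ?A + card ?B = card (?A \<union> ?B)"
      by (subst card_Un_disjoint) auto
    also have "\<dots> \<le> card ?P"
      by (rule card_mono[OF _ sub]) simp
    also have "\<dots> = p\<^sup>2"
      by (simp add: card_cartesian_product power2_eq_square)
    finally show False using A B by linarith
  qed
  then obtain s t where st: "s \<in> ?T" "t \<in> ?T"
    "triple_sum (x 2) (x 1) (x 0) s = triple_sum (x 5) (x 4) (x 3) t"
    by blast
  obtain a b c where s: "s = (a, b, c)" by (cases s)
  obtain d e f where t: "t = (d, e, f)" by (cases t)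
  \<comment> \<open>The common value is subtracted from itself: the second triple enters with the
    opposite sign. Each half lists its roots backwards to match the descending indices.\<close>
  define w where "w i = [c\<^sup>2, b\<^sup>2, a\<^sup>2, -1 * f\<^sup>2, -1 * e\<^sup>2, -1 * d\<^sup>2] ! i" for i
  have sq: "unit_square (y\<^sup>2)" "unit_square (-1 * y\<^sup>2)" if "y \<in> units" for y
    using unit_square_mult[OF unit_square_minus_1] unit_square_power2 not_dvd_of_unit[OF that] by blast+
  have *: "{..<6::nat} = {0, 1, 2, 3, 4, 5}" by auto
  have "unit_square (w i)" if "i < 6" for i
  proof -
    have "i \<in> {0, 1, 2, 3, 4, 5}" using that * by blast
    thus ?thesis using sq st s t by (auto simp: w_def)
  qed
  moreover have "int p dvd (\<Sum>i<(6::nat). w i * x i)" "int p dvd (\<Sum>i<(6::nat). w i)"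
    using st unfolding s t * by (auto simp: w_def triple_sum_def mod_eq_dvd_iff algebra_simps)
  ultimately show ?thesis by blast
qed

section \<open>From the residue ring to divisibility of integers\<close>

lemma residues_p: "residues (int p)"
  using p_ge_13 by unfold_locales simp

lemma unit_squares_iff: "a \<in> unit_squares p \<longleftrightarrow> 0 \<le> a \<and> a < int p \<and> unit_square a"
proof -
  interpret residues_prime p "residue_ring (int p)"
    by unfold_locales (rule prime)
  have U: "Units (residue_ring (int p)) = units"
    using p_ge_13 by (simp add: res_prime_units_eq of_nat_diff)
  have pow: "x [^]\<^bsub>residue_ring (int p)\<^esub> (2::nat) = x\<^sup>2 mod int p" if "x \<in> units" for x
    using pow_cong[of x 2] that by simp
  show ?thesis
  proof
    assume "a \<in> unit_squares p"
    then obtain x where x: "x \<in> units" "a = x\<^sup>2 mod int p"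
      unfolding unit_squares_def U using pow by auto
    have "int p dvd a - x\<^sup>2" using x by (simp flip: mod_eq_dvd_iff)
    hence "unit_square a" using unit_square_power2 not_dvd_of_unit[OF x(1)] unit_square_cong by blast
    thus "0 \<le> a \<and> a < int p \<and> unit_square a" using x p_ge_13 by simp
  next
    assume a: "0 \<le> a \<and> a < int p \<and> unit_square a"
    then obtain y where y: "\<not> int p dvd y" "int p dvd a - y\<^sup>2" by (auto simp: unit_square_def)
    have "a mod int p = y\<^sup>2 mod int p" using y by (simp add: mod_eq_dvd_iff)
    hence "a = (y mod int p)\<^sup>2 mod int p" using a by (simp add: power_mod)
    thus "a \<in> unit_squares p"
      unfolding unit_squares_def U using pow[OF mod_in_units] mod_in_units y(1) by force
  qed
qed

lemma finsum_residue_ring: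
  assumes "finite A" "\<And>i. i \<in> A \<Longrightarrow> f i \<in> carrier (residue_ring (int p))"
  shows "(\<Oplus>\<^bsub>residue_ring (int p)\<^esub>i\<in>A. f i) = (\<Sum>i\<in>A. f i) mod int p"
proof -
  interpret residues "int p" "residue_ring (int p)"
    using residues_p by simp
  have "(\<Oplus>\<^bsub>residue_ring (int p)\<^esub>i\<in>A. f i) = (\<Oplus>\<^bsub>residue_ring (int p)\<^esub>i\<in>A. f i mod int p)"
    using assms(2) by (intro finsum_cong') (auto simp: res_carrier_eq)
  thus ?thesis using sum_cong[OF assms(1)] by simp
qed

text \<open>Integer weights need not be reduced: replacing each by its remainder modulo p yields
  elements of \<open>unit_squares p\<close> and preserves both sums modulo p.\<close>

lemma weighted_zero_sum_iff:
  "weighted_zero_sum p (unit_squares p) xs \<longleftrightarrow>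
    (\<exists>a. (\<forall>i<length xs. unit_square (a i)) \<and> int p dvd (\<Sum>i<length xs. a i * xs ! i)
      \<and> int p dvd (\<Sum>i<length xs. a i))"
proof -
  interpret residues "int p" "residue_ring (int p)"
    using residues_p by simp
  let ?n = "length xs"
  have s1: "(\<Oplus>\<^bsub>residue_ring (int p)\<^esub>i\<in>{..<?n}. a i \<otimes>\<^bsub>residue_ring (int p)\<^esub> xs ! i)
      = (\<Sum>i<?n. a i * xs ! i) mod int p" for a
    unfolding res_mult_eq by (rule sum_cong) simp
  have s2: "(\<Oplus>\<^bsub>residue_ring (int p)\<^esub>i\<in>{..<?n}. a i) = (\<Sum>i<?n. a i) mod int p"
    if "\<forall>i<?n. a i \<in> unit_squares p" for a
    using that by (intro finsum_residue_ring) (auto simp: unit_squares_iff res_carrier_eq)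
  show ?thesis
  proof
    assume "weighted_zero_sum p (unit_squares p) xs"
    then obtain a where "\<forall>i<?n. a i \<in> unit_squares p" "(\<Sum>i<?n. a i * xs ! i) mod int p = 0"
      "(\<Sum>i<?n. a i) mod int p = 0"
      unfolding weighted_zero_sum_def s1 res_zero_eq using s2 by auto
    thus "\<exists>a. (\<forall>i<?n. unit_square (a i)) \<and> int p dvd (\<Sum>i<?n. a i * xs ! i) \<and> int p dvd (\<Sum>i<?n. a i)"
      unfolding unit_squares_iff dvd_eq_mod_eq_0 by (intro exI[of _ a]) simp
  next
    assume "\<exists>a. (\<forall>i<?n. unit_square (a i)) \<and> int p dvd (\<Sum>i<?n. a i * xs ! i) \<and> int p dvd (\<Sum>i<?n. a i)"
    then obtain a where a: "\<forall>i<?n. unit_square (a i)" "(\<Sum>i<?n. a i * xs ! i) mod int p = 0"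
      "(\<Sum>i<?n. a i) mod int p = 0"
      by auto
    let ?b = "\<lambda>i. a i mod int p"
    have b: "\<forall>i<?n. ?b i \<in> unit_squares p"
      using a(1) p_ge_13 unfolding unit_squares_iff
      by (auto intro: unit_square_cong simp flip: mod_eq_dvd_iff)
    have "(\<Sum>i<?n. ?b i * xs ! i) mod int p = (\<Sum>i<?n. (?b i * xs ! i) mod int p) mod int p"
      by (simp add: mod_sum_eq)
    also have "\<dots> = (\<Sum>i<?n. a i * xs ! i) mod int p"
      by (simp add: mod_mult_left_eq mod_sum_eq)
    finally have "(\<Sum>i<?n. ?b i * xs ! i) mod int p = 0" using a by simp
    moreover have "(\<Sum>i<?n. ?b i) mod int p = 0"
      using a by (simp add: mod_sum_eq)
    ultimately show "weighted_zero_sum p (unit_squares p) xs"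
      unfolding weighted_zero_sum_def s1 res_zero_eq using b s2[OF b] by (intro exI[of _ ?b]) auto
  qed
qed

section \<open>Six terms suffice, five do not\<close>

text \<open>Two equal neighbours form a block by themselves; without such neighbours the whole
  sequence is a weighted zero-sum sequence.\<close>

lemma weighted_zero_sum_sublist_of_six:
  assumes "length xs = 6" "set xs \<subseteq> carrier (residue_ring (int p))"
  shows "\<exists>ys. ys \<noteq> [] \<and> sublist ys xs \<and> weighted_zero_sum p (unit_squares p) ys"
proof (cases "\<exists>i<5. xs ! i = xs ! Suc i")
  case True
  then obtain i where i: "i < 5" "xs ! i = xs ! Suc i" by blast
  define v where "v = xs ! i"
  have "drop i xs = v # v # drop (i + 2) xs"
    using i assms(1) Cons_nth_drop_Suc[of i xs] Cons_nth_drop_Suc[of "Suc i" xs] by (simp add: v_def)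
  hence "xs = take i xs @ [v, v] @ drop (i + 2) xs"
    by (metis append_Cons append_Nil append_take_drop_id)
  hence "sublist [v, v] xs" unfolding sublist_def by blast
  moreover have "weighted_zero_sum p (unit_squares p) [v, v]"
    unfolding weighted_zero_sum_iff using unit_square_minus_1 unit_square_power2[of 1] not_p_dvd[of 1]
    by (intro exI[of _ "\<lambda>i. if i = 0 then 1 else -1"]) (auto simp: numeral_2_eq_2 lessThan_Suc)
  ultimately show ?thesis by blast
next
  case False
  have carrier: "0 \<le> xs ! i \<and> xs ! i < int p" if "i < 6" for i
  proof -
    have "xs ! i \<in> carrier (residue_ring (int p))"
      using assms nth_mem[of i xs] that by (intro subsetD[OF assms(2)]) simp
    thus ?thesis by (simp add: residue_ring_def)
  qed
  have eq: "int p dvd xs ! i - xs ! j \<longleftrightarrow> xs ! i = xs ! j" if "i < 6" "j < 6" for i j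
    using carrier[OF that(1)] carrier[OF that(2)] by (simp flip: mod_eq_dvd_iff)
  have "\<exists>a. (\<forall>i<6. unit_square (a i)) \<and> int p dvd (\<Sum>i<(6::nat). a i * xs ! i) \<and> int p dvd (\<Sum>i<(6::nat). a i)"
  proof (cases "\<exists>i<6. \<exists>j<i. xs ! i = xs ! j")
    case True
    then obtain i j where ij: "i < 6" "j < i" "xs ! i = xs ! j" by blast
    define v where "v = xs ! i"
    have neq: "xs ! 0 \<noteq> xs ! 1" "xs ! 2 \<noteq> xs ! 3" "xs ! 4 \<noteq> xs ! 5"
      using False by (force simp: eval_nat_numeral)+
    \<comment> \<open>Each of three disjoint adjacent pairs has two different entries, hence at
      least one different from v.\<close>
    obtain k l m where klm: "k \<in> {0, 1}" "l \<in> {2, 3}" "m \<in> {4, 5}"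
      "xs ! k \<noteq> v" "xs ! l \<noteq> v" "xs ! m \<noteq> v"
      using neq by (metis insertCI)
    have "\<exists>a. (\<forall>i\<in>{..<6}. unit_square (a i)) \<and> int p dvd (\<Sum>i<(6::nat). a i * xs ! i) \<and> int p dvd (\<Sum>i<(6::nat). a i)"
      by (rule unit_square_weights_of_repetition[of _ i j _ v k l m])
        (use ij klm eq[of _ i] in \<open>auto simp: v_def\<close>)
    thus ?thesis by (simp only: Ball_def lessThan_iff)
  next
    case False
    show ?thesis
      by (rule unit_square_weights_of_distinct_six) (use False eq in auto)
  qed
  hence "weighted_zero_sum p (unit_squares p) xs"
    unfolding weighted_zero_sum_iff assms(1) .
  thus ?thesis using assms(1) by (intro exI[of _ xs]) auto
qed

text \<open>The zeros are never adjacent, so a block without 1 and n is \<open>[0]\<close>, whose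
  single weight cannot vanish. A block with exactly one of 1 and n would force the weight there to
  vanish, and a block with both would make n a square.\<close>

lemma no_weighted_zero_sum_sublist:
  assumes n: "0 < n" "n < int p" "\<not> unit_square n"
    and ys: "ys \<noteq> []" "sublist ys [0, 1, 0, n, 0]"
  shows "\<not> weighted_zero_sum p (unit_squares p) ys"
proof
  assume "weighted_zero_sum p (unit_squares p) ys"
  then obtain a where a: "\<forall>i<length ys. unit_square (a i)" "int p dvd (\<Sum>i<length ys. a i * ys ! i)"
    "int p dvd (\<Sum>i<length ys. a i)"
    unfolding weighted_zero_sum_iff by blast
  have nn: "\<not> int p dvd n" using n zdvd_not_zless by blast
  have 1: "\<not> unit_square u" if "int p dvd u" for u using that unit_square_not_dvd by blast
  have 2: "\<not> unit_square u" if "int p dvd u * n" for u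
    using that 1 nn by (simp add: p_dvd_mult_iff)
  have 3: "\<not> unit_square u \<or> \<not> unit_square w" if "int p dvd u + w * n" for u w
  proof (rule ccontr)
    assume "\<not> ?thesis"
    hence u: "unit_square u" "unit_square w" by auto
    then obtain i where i: "int p dvd w * i - 1" "\<not> int p dvd i"
      using obtain_inverse unit_square_not_dvd by metis
    \<comment> \<open>Since \<open>i\<close> inverts \<open>w\<close>, this number represents -u/w,
      the value that the congruence forces on n.\<close>
    have "unit_square (-1 * u * w * i\<^sup>2)"
      using u i by (intro unit_square_mult unit_square_minus_1 unit_square_power2)
    moreover have "n - (-1 * u * w * i\<^sup>2) = (u + w * n) * w * i\<^sup>2 - n * (w * i + 1) * (w * i - 1)"
      by (simp add: algebra_simps power2_eq_square)
    hence "int p dvd n - (-1 * u * w * i\<^sup>2)"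
      using that i by simp
    ultimately show False using n(3) unit_square_cong by blast
  qed
  have 4: "\<not> unit_square u \<or> \<not> unit_square w" if "int p dvd u * n + w" for u w
    using 3[of w u] that by (auto simp: add.commute)
  have "ys \<in> set (sublists [0, 1, 0, n, 0])"
    using ys(2) by (subst in_set_sublists)
  hence "ys \<in> {[0], [1], [n], [0, 1], [1, 0], [0, n], [n, 0], [0, 1, 0], [1, 0, n], [0, n, 0],
      [0, 1, 0, n], [1, 0, n, 0], [0, 1, 0, n, 0]}"
    using ys(1) by (auto simp del: in_set_sublists)
  thus False
    using a 1 2 3 4 by (auto simp: eval_nat_numeral lessThan_Suc All_less_Suc)
qed

end

theorem theorem3p8:
  fixes p :: nat
  assumes "prime p" and "odd p" and "[p = 1] (mod 4)" and "p \<noteq> 5"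
  shows "weighted_zero_sum_constant p (unit_squares p) = 6"
proof -
  interpret prime_1_mod_4 p
    using assms by unfold_locales
  define P where "P k \<longleftrightarrow> 0 < k \<and>
    (\<forall>xs. length xs = k \<and> set xs \<subseteq> carrier (residue_ring (int p)) \<longrightarrow>
      (\<exists>ys. ys \<noteq> [] \<and> sublist ys xs \<and> weighted_zero_sum p (unit_squares p) ys))" for k
  have "Inf {k. P k} = 6"
  proof (rule cInf_eq_minimum)
    show "6 \<in> {k. P k}"
      using weighted_zero_sum_sublist_of_six by (simp add: P_def)
  next
    fix k assume "k \<in> {k. P k}"
    hence k: "P k" by simp
    obtain n where n: "0 < n" "n < int p" "\<not> unit_square n"
      by (rule exists_nonsquare)
    let ?xs = "[0, 1, 0, n, 0]"
    show "6 \<le> k"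
    proof (rule ccontr)
      assume "\<not> 6 \<le> k"
      \<comment> \<open>Every block of a prefix is a block of the five-term example, so this one
        sequence rules out all lengths below 6.\<close>
      hence "length (take k ?xs) = k" by simp
      moreover have "set (take k ?xs) \<subseteq> carrier (residue_ring (int p))"
        using set_take_subset[of k ?xs] n by (auto simp: residue_ring_def)
      ultimately obtain ys where "ys \<noteq> []" "sublist ys (take k ?xs)"
        "weighted_zero_sum p (unit_squares p) ys"
        using k unfolding P_def by blast
      moreover have "sublist (take k ?xs) ?xs"
        by (rule sublist_take)
      ultimately show False
        using no_weighted_zero_sum_sublist[OF n] sublist_order.order_trans by blast
    qed
  qed
  thus ?thesis
    unfolding weighted_zero_sum_constant_def P_def .
qed

end
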